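(* Assume full utilization of the helper's CPU, i.e. $\ell=U_K$. Let $\mathcal{T}(\ell)$ be the offloading feasibility tunnel, and let $\boldsymbol{\ell}^*$ be the energy-efficient policy, i.e. the solution of $$\min_{\boldsymbol{\ell}\ge \boldsymbol 0}\ \sum_{k=1}^{K}\frac{\tau_k}{h^2}\,g\!\left(\frac{\ell_k}{\tau_k}\right)\quad\text{s.t. } \boldsymbol{\ell}\in\mathcal{T}(\ell).$$ Then $\boldsymbol{\ell}^*$ is given by the shortest path in $\mathcal{T}(\ell)$ connecting the points $(0,0)$ and $(T_{\rm end},\ell)$. Specifically, $\ell_k^*=r_k^*\tau_k$, where a policy in $\mathcal{T}(\ell)$ with nonnegative rates $r_k=\ell_k/\tau_k$ is optimal (i.e. $r_k=r_k^*$ for all $k$) if and only if the following conditions hold: 1) the offloading rate does not change unless the helper CPU changes its state; 2) the offloading rate can increase only at an instant at which the helper CPU changes to the idle state, and in this case the buffer is fully occupied at that instant: if $r_{k+1}>r_k$ (change at time $s_k$), then epoch $k+1$ is idle ($a_{k+1}=1$) and $B_k=Q$; 3) the offloading rate can decrease only at an instant at which the helper CPU changes to the busy state, and in this case the buffer is empty at that instant: if $r_{k+1}<r_k$ (change at time $s_k$), then epoch $k+1$ is busy ($a_{k+1}=0$) and $B_k=0$.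
   Context: Setting. A user offloads data to a helper. The helper's CPU alternates between idle and busy states; state changes occur at times $0=s_0<s_1<\dots<s_K=T_{\rm end}$, and epoch $k$ is the interval $[s_{k-1},s_k]$ of length $\tau_k=s_k-s_{k-1}$. The indicator $a_k\in\{0,1\}$ equals $1$ if the CPU is idle in epoch $k$ and $0$ if busy; consecutive epochs have different states and the last epoch $K$ is idle. The helper's CPU frequency is $f_h>0$ and $C>0$ is the number of CPU cycles needed per bit. The CPU-idling profile is $U_k=\sum_{j=1}^k a_j\tau_j f_h/C$. The helper has a buffer of size $Q>0$ bits. An offloading policy is a vector $\boldsymbol{\ell}=(\ell_1,\dots,\ell_K)\ge\boldsymbol 0$, $\ell_k$ being the number of bits offloaded in epoch $k$ at the constant rate $r_k=\ell_k/\tau_k$; $\ell$ is the total offloaded data size. The transmission energy is $\sum_k \frac{\tau_k}{h^2}g(\ell_k/\tau_k)$ with $g(x)=N_0(2^{x/W}-1)$, where $h,N_0,W>0$ are constants. When $\ell=U_K$, all idle CPU resource must be used, so the number of bits in the buffer at time $s_k$ (the end of epoch $k$) is $B_k=\sum_{j=1}^k\ell_j-U_k$. The offloading feasibility tunnel is $$\mathcal{T}(\ell)=\Big\{\boldsymbol{\ell}\ :\ U_k\le\sum_{j=1}^k\ell_j\le\min\{U_k+Q,\ell\},\ k=1,\dots,K-1,\ \sum_{k=1}^K\ell_k=\ell\Big\}.$$ The path of a policy is the piecewise-linear curve through the points $(s_k,\sum_{j=1}^k\ell_j)$, $k=0,\dots,K$; its length is $\sum_{k=1}^K\sqrt{\ell_k^2+\tau_k^2}$.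 The shortest path in a tunnel is the path of minimum length among policies in it. *)

theory Defs
  imports "HOL-Analysis.Analysis"
begin

text \<open>
  Epochs are numbered \<open>1, \<dots>, K\<close>; epoch \<open>k\<close> is the interval from \<open>s (k - 1)\<close> to \<open>s k\<close>.
  A vector \<open>(l\<^sub>1, \<dots>, l\<^sub>K)\<close> is an extensional function on \<open>{1..K}\<close>, so that equality of
  vectors is equality of functions.
\<close>

definition epoch_len :: "(nat \<Rightarrow> real) \<Rightarrow> nat \<Rightarrow> real" where
  "epoch_len s k = s k - s (k - 1)"

definition idling_profile ::
    "(nat \<Rightarrow> real) \<Rightarrow> (nat \<Rightarrow> nat) \<Rightarrow> real \<Rightarrow> real \<Rightarrow> nat \<Rightarrow> real" where
  "idling_profile s a fh C k = (\<Sum>j=1..k. real (a j) * epoch_len s j * fh / C)"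

definition policies :: "nat \<Rightarrow> (nat \<Rightarrow> real) set" where
  "policies K = {1..K} \<rightarrow>\<^sub>E {0..}"

definition offload_rate :: "(nat \<Rightarrow> real) \<Rightarrow> (nat \<Rightarrow> real) \<Rightarrow> nat \<Rightarrow> real" where
  "offload_rate s l k = l k / epoch_len s k"

definition energy_rate :: "real \<Rightarrow> real \<Rightarrow> real \<Rightarrow> real" where
  "energy_rate N0 W x = N0 * (2 powr (x / W) - 1)"

definition energy ::
    "nat \<Rightarrow> (nat \<Rightarrow> real) \<Rightarrow> real \<Rightarrow> real \<Rightarrow> real \<Rightarrow> (nat \<Rightarrow> real) \<Rightarrow> real" where
  "energy K s h N0 W l =
     (\<Sum>k=1..K. epoch_len s k / h\<^sup>2 * energy_rate N0 W (l k / epoch_len s k))"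

text \<open>Bits in the buffer at time \<open>s k\<close> under full utilization of the idle CPU.\<close>

definition buffer ::
    "(nat \<Rightarrow> real) \<Rightarrow> (nat \<Rightarrow> nat) \<Rightarrow> real \<Rightarrow> real \<Rightarrow> (nat \<Rightarrow> real) \<Rightarrow> nat \<Rightarrow> real" where
  "buffer s a fh C l k = (\<Sum>j=1..k. l j) - idling_profile s a fh C k"

definition tunnel ::
    "nat \<Rightarrow> (nat \<Rightarrow> real) \<Rightarrow> (nat \<Rightarrow> nat) \<Rightarrow> real \<Rightarrow> real \<Rightarrow> real \<Rightarrow> real \<Rightarrow> (nat \<Rightarrow> real) set" where
  "tunnel K s a fh C Q L =
     {l \<in> policies K.
        (\<forall>k\<in>{1..<K}. idling_profile s a fh C k \<le> (\<Sum>j=1..k. l j) \<and>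
                     (\<Sum>j=1..k. l j) \<le> min (idling_profile s a fh C k + Q) L) \<and>
        (\<Sum>k=1..K. l k) = L}"

definition energy_efficient ::
    "nat \<Rightarrow> (nat \<Rightarrow> real) \<Rightarrow> (nat \<Rightarrow> nat) \<Rightarrow> real \<Rightarrow> real \<Rightarrow> real \<Rightarrow> real \<Rightarrow> real \<Rightarrow> real \<Rightarrow> real
     \<Rightarrow> (nat \<Rightarrow> real) \<Rightarrow> bool" where
  "energy_efficient K s a fh C Q h N0 W L l \<longleftrightarrow>
     is_arg_min (energy K s h N0 W) (\<lambda>l. l \<in> tunnel K s a fh C Q L) l"

text \<open>
  The path of a policy is the polygonal curve through its vertices \<open>k = 0, \<dots>, K\<close>, and
  \<open>path_len\<close> is the Euclidean length of that curve.
\<close>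

definition path_vertex :: "(nat \<Rightarrow> real) \<Rightarrow> (nat \<Rightarrow> real) \<Rightarrow> nat \<Rightarrow> real \<times> real" where
  "path_vertex s l k = (s k, \<Sum>j=1..k. l j)"

definition path_len :: "nat \<Rightarrow> (nat \<Rightarrow> real) \<Rightarrow> (nat \<Rightarrow> real) \<Rightarrow> real" where
  "path_len K s l = (\<Sum>k=1..K. sqrt ((l k)\<^sup>2 + (epoch_len s k)\<^sup>2))"

definition shortest_path ::
    "nat \<Rightarrow> (nat \<Rightarrow> real) \<Rightarrow> (nat \<Rightarrow> real) set \<Rightarrow> real \<times> real \<Rightarrow> real \<times> real
     \<Rightarrow> (nat \<Rightarrow> real) \<Rightarrow> bool" where
  "shortest_path K s S p q l \<longleftrightarrow>
     is_arg_min (path_len K s)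
       (\<lambda>l. l \<in> S \<and> path_vertex s l 0 = p \<and> path_vertex s l K = q) l"

text \<open>
  \<open>step_fun K s v\<close> is the function of time with value \<open>v k\<close> throughout epoch \<open>k\<close>;
  with \<open>v\<close> the epoch rates or the epoch states it gives the offloading rate and the CPU state
  at each instant. A function changes at an instant if it is not constant near it.
\<close>

definition step_fun :: "nat \<Rightarrow> (nat \<Rightarrow> real) \<Rightarrow> (nat \<Rightarrow> real) \<Rightarrow> real \<Rightarrow> real" where
  "step_fun K s v t = (\<Sum>k=1..K. if s (k - 1) \<le> t \<and> t < s k then v k else 0)"

definition changes_at :: "(real \<Rightarrow> real) \<Rightarrow> real \<Rightarrow> bool" where
  "changes_at f t \<longleftrightarrow> \<not> (\<exists>c. \<forall>\<^sub>F u in nhds t. f u = c)"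

definition rate_changes_with_state ::
    "nat \<Rightarrow> (nat \<Rightarrow> real) \<Rightarrow> (nat \<Rightarrow> nat) \<Rightarrow> (nat \<Rightarrow> real) \<Rightarrow> bool" where
  "rate_changes_with_state K s a l \<longleftrightarrow>
     (\<forall>t\<in>{s 0<..<s K}. changes_at (step_fun K s (offload_rate s l)) t \<longrightarrow>
                        changes_at (step_fun K s (\<lambda>k. real (a k))) t)"

definition increases_at_full_buffer ::
    "nat \<Rightarrow> (nat \<Rightarrow> real) \<Rightarrow> (nat \<Rightarrow> nat) \<Rightarrow> real \<Rightarrow> real \<Rightarrow> real \<Rightarrow> (nat \<Rightarrow> real) \<Rightarrow> bool" where
  "increases_at_full_buffer K s a fh C Q l \<longleftrightarrow>
     (\<forall>k\<in>{1..<K}. offload_rate s l (k + 1) > offload_rate s l k \<longrightarrow>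
                   a (k + 1) = 1 \<and> buffer s a fh C l k = Q)"

definition decreases_at_empty_buffer ::
    "nat \<Rightarrow> (nat \<Rightarrow> real) \<Rightarrow> (nat \<Rightarrow> nat) \<Rightarrow> real \<Rightarrow> real \<Rightarrow> (nat \<Rightarrow> real) \<Rightarrow> bool" where
  "decreases_at_empty_buffer K s a fh C l \<longleftrightarrow>
     (\<forall>k\<in>{1..<K}. offload_rate s l (k + 1) < offload_rate s l k \<longrightarrow>
                   a (k + 1) = 0 \<and> buffer s a fh C l k = 0)"

end

theory Submission
  imports Defs
begin

text \<open>
  Both the energy and the path length have the form \<open>\<Sum>k. \<tau>\<^sub>k * \<phi> (l\<^sub>k / \<tau>\<^sub>k)\<close> with \<open>\<phi>\<close> strictly
  convex, and conditions 2) and 3) do not mention \<open>\<phi>\<close>. They are sufficient for being the strict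
  minimiser: bound \<open>\<phi>\<close> from below by its tangents at the rates and sum by parts; a rate increase
  (decrease) meets a path that touches the upper (lower) wall of the tunnel, so every summand is
  nonnegative. They are necessary: otherwise moving a few bits between two adjacent epochs brings
  their rates closer together, which lowers the cost. Hence minimisers for different \<open>\<phi>\<close> coincide,
  and existence, by compactness, is needed for one \<open>\<phi>\<close> only. Condition 1) always holds, because
  the state changes at every epoch boundary.
\<close>

section \<open>Strict convexity through supporting lines\<close>

text \<open>\<open>d x\<close> is the slope of a line that touches the graph of
  \<open>\<phi>\<close> at \<open>x\<close> and lies strictly below it elsewhere. With
  \<open>d\<close> explicit, slopes at different rates can be compared and summed by parts.\<close>

definition strict_subgradient :: "(real \<Rightarrow> real) \<Rightarrow> (real \<Rightarrow> real) \<Rightarrow> bool" where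
  "strict_subgradient \<phi> d \<longleftrightarrow> (\<forall>x y. x \<noteq> y \<longrightarrow> \<phi> x + d x * (y - x) < \<phi> y)"

lemma strict_subgradientD:
  "strict_subgradient \<phi> d \<Longrightarrow> x \<noteq> y \<Longrightarrow> \<phi> x + d x * (y - x) < \<phi> y"
  by (auto simp: strict_subgradient_def)

lemma strict_subgradient_le:
  "strict_subgradient \<phi> d \<Longrightarrow> \<phi> x + d x * (y - x) \<le> \<phi> y"
  by (cases "x = y") (auto dest: strict_subgradientD intro: less_imp_le)

text \<open>Adding the tangent inequalities at \<open>x\<close> and at \<open>y\<close> cancels the
  values of \<open>\<phi>\<close>.\<close>

lemma strict_subgradient_mono:
  assumes "strict_subgradient \<phi> d" "x \<le> y"
  shows "d x \<le> d y"
proof (cases "x = y")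
  case False
  with assms have "0 < y - x" by simp
  moreover have "d x * (y - x) < d y * (y - x)"
    using strict_subgradientD[OF assms(1) False] strict_subgradientD[OF assms(1) False[symmetric]]
    by (simp add: algebra_simps)
  ultimately show ?thesis by (simp add: mult_less_cancel_right)
qed simp

text \<open>By the mean value theorem the secant slope is \<open>d z\<close> for some
  \<open>z\<close> strictly between the two points; strict monotonicity compares it with
  \<open>d x\<close>.\<close>

lemma strict_subgradient_deriv:
  assumes "\<And>x. (\<phi> has_real_derivative d x) (at x)" and "strict_mono d"
  shows "strict_subgradient \<phi> d"
  unfolding strict_subgradient_def
proof (intro allI impI)
  fix x y :: real
  assume "x \<noteq> y"
  then consider "x < y" | "y < x" by linarith
  then show "\<phi> x + d x * (y - x) < \<phi> y"
  proof cases
    case 1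
    then obtain z where z: "x < z" "\<phi> y - \<phi> x = (y - x) * d z"
      using MVT2[of x y \<phi> d] assms(1) by blast
    then have "d x * (y - x) < d z * (y - x)"
      using 1 strict_monoD[OF assms(2)] by simp
    then show ?thesis using z by (simp add: mult.commute)
  next
    case 2
    then obtain z where z: "z < x" "\<phi> x - \<phi> y = (x - y) * d z"
      using MVT2[of y x \<phi> d] assms(1) by blast
    then have "d z * (x - y) < d x * (x - y)"
      using 2 strict_monoD[OF assms(2)] by simp
    then show ?thesis using z by (simp add: algebra_simps)
  qed
qed

lemma strict_subgradient_energy_rate:
  assumes "N0 > 0" "W > 0" "h > (0::real)"
  shows "strict_subgradient (\<lambda>x. energy_rate N0 W x / h\<^sup>2)
           (\<lambda>x. N0 * ln 2 / (W * h\<^sup>2) * 2 powr (x / W))"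
proof (rule strict_subgradient_deriv)
  fix x :: real
  show "((\<lambda>x. energy_rate N0 W x / h\<^sup>2) has_real_derivative
           N0 * ln 2 / (W * h\<^sup>2) * 2 powr (x / W)) (at x)"
    unfolding energy_rate_def using assms
    by (auto intro!: derivative_eq_intros simp: field_simps)
  show "strict_mono (\<lambda>x. N0 * ln 2 / (W * h\<^sup>2) * 2 powr (x / W))"
    using assms by (intro strict_monoI mult_strict_left_mono) (auto simp: divide_strict_right_mono)
qed

text \<open>This is the strict Cauchy-Schwarz inequality for the vectors \<open>(x, 1)\<close> and
  \<open>(y, 1)\<close>, which are parallel only if \<open>x = y\<close>.\<close>

lemma strict_subgradient_sqrt:
  "strict_subgradient (\<lambda>x. sqrt (x\<^sup>2 + 1)) (\<lambda>x. x / sqrt (x\<^sup>2 + 1))"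
  unfolding strict_subgradient_def
proof (intro allI impI)
  fix x y :: real
  assume "x \<noteq> y"
  let ?u = "sqrt (x\<^sup>2 + 1)" and ?v = "sqrt (y\<^sup>2 + 1)"
  have pos: "?u > 0" by (simp add: add_nonneg_pos)
  \<comment> \<open>Lagrange's identity in the plane.\<close>
  have "(x * y + 1)\<^sup>2 + (x - y)\<^sup>2 = (x\<^sup>2 + 1) * (y\<^sup>2 + 1)"
    by (simp add: power2_eq_square algebra_simps)
  moreover have "(x - y)\<^sup>2 > 0" using \<open>x \<noteq> y\<close> by simp
  ultimately have "(x * y + 1)\<^sup>2 < (x\<^sup>2 + 1) * (y\<^sup>2 + 1)" by linarith
  then have "x * y + 1 < sqrt ((x\<^sup>2 + 1) * (y\<^sup>2 + 1))" by (rule real_less_rsqrt)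
  then have "x * y + 1 < ?u * ?v" by (simp add: real_sqrt_mult)
  moreover have "?u + x / ?u * (y - x) = (x * y + 1) / ?u"
    using pos by (simp add: field_simps power2_eq_square)
  ultimately show "?u + x / ?u * (y - x) < ?v"
    using pos by (simp add: pos_divide_less_eq mult.commute)
qed

section \<open>Summation by parts and transfers between entries\<close>

text \<open>Abel summation: it turns a weighted sum of entries into one of prefix sums, which are
  what the tunnel bounds.\<close>

lemma sum_by_parts:
  fixes c x :: "nat \<Rightarrow> real"
  assumes "1 \<le> n"
  shows "(\<Sum>k=1..n. c k * x k) =
    c n * (\<Sum>j=1..n. x j) + (\<Sum>k=1..<n. (c k - c (k + 1)) * (\<Sum>j=1..k. x j))"
  using assms
proof (induction n rule: dec_induct)
  case (step n)
  then show ?case by (simp add: algebra_simps)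
qed simp

lemma sum_two_updates:
  fixes f :: "nat \<Rightarrow> 'b \<Rightarrow> real"
  assumes "finite A" "i \<in> A" "j \<in> A" "i \<noteq> j"
  shows "(\<Sum>k\<in>A. f k ((l(i := x, j := y)) k)) =
    (\<Sum>k\<in>A. f k (l k)) + (f i x - f i (l i)) + (f j y - f j (l j))"
proof -
  have split: "(\<Sum>k\<in>A. g k) = g i + (g j + (\<Sum>k\<in>A - {i} - {j}. g k))" for g :: "nat \<Rightarrow> real"
    using assms by (simp add: sum.remove)
  have "(\<Sum>k\<in>A - {i} - {j}. f k ((l(i := x, j := y)) k)) = (\<Sum>k\<in>A - {i} - {j}. f k (l k))"
    by (rule sum.cong) auto
  then show ?thesis
    using assms(4) by (simp only: split) simp
qed

text \<open>What is added in entry \<open>k\<close> is taken back in entry \<open>k + 1\<close>, so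
  the path moves at a single vertex.\<close>

lemma sum_shift_adjacent:
  fixes l :: "nat \<Rightarrow> real"
  assumes "1 \<le> k"
  shows "(\<Sum>j=1..m. (l(k := l k + e, k + 1 := l (k + 1) - e)) j) =
    (\<Sum>j=1..m. l j) + (if m = k then e else 0)"
  using assms by (induction m) auto

section \<open>Step functions of time and their jumps\<close>

lemma strictly_inc_epochs:
  fixes s :: "nat \<Rightarrow> real"
  assumes "\<forall>k\<in>{1..K}. s (k - 1) < s k" "i < j" "j \<le> K"
  shows "s i < s j"
  using assms(2,3)
proof (induction j)
  case (Suc j)
  then show ?case
    using assms(1)[rule_format, of "Suc j"] by (cases "i = j") auto
qed simp

lemma step_fun_epoch:
  assumes "\<forall>k\<in>{1..K}. s (k - 1) < s k" "k \<in> {1..K}" "s (k - 1) \<le> t" "t < s k"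
  shows "step_fun K s v t = v k"
proof -
  have "(s (j - 1) \<le> t \<and> t < s j) \<longleftrightarrow> j = k" if "j \<in> {1..K}" for j
  proof -
    have le: "s i \<le> s m" if "i \<le> m" "m \<le> K" for i m
      using strictly_inc_epochs[OF assms(1), of i m] that by (cases "i = m") auto
    consider "j < k" | "j = k" | "k < j" by linarith
    then show ?thesis
    proof cases
      case 1
      then have "s j \<le> s (k - 1)" using assms(2) by (intro le) auto
      then show ?thesis using 1 assms(3) by simp
    next
      case 3
      then have "s k \<le> s (j - 1)" using that by (intro le) auto
      then show ?thesis using 3 assms(4) by simp
    qed (use assms in simp)
  qed
  then have "step_fun K s v t = (\<Sum>j=1..K. if j = k then v k else 0)"
    unfolding step_fun_def by (intro sum.cong) auto
  then show ?thesis using assms(2) by simp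
qed

lemma changes_at_imp_boundary:
  assumes inc: "\<forall>k\<in>{1..K}. s (k - 1) < s k"
    and t: "t \<in> {s 0<..<s K}" and ch: "changes_at (step_fun K s v) t"
  shows "\<exists>k\<in>{1..<K}. t = s k"
proof -
  \<comment> \<open>The epoch containing \<open>t\<close>: minimality gives
    \<open>s (k - 1) \<le> t < s k\<close>. In the open epoch the step function is locally constant,
    so only the left end is left for \<open>t\<close>.\<close>
  define k where "k = (LEAST k. t < s k)"
  have "t < s K" "s 0 < t" using t by auto
  have k: "t < s k" unfolding k_def by (rule LeastI) fact
  have least: "s i \<le> t" if "i < k" for i
    using not_less_Least[of i "\<lambda>k. t < s k"] that by (simp add: k_def not_less)
  have "k \<le> K" unfolding k_def by (rule Least_le) fact
  have "k \<noteq> 0" using k \<open>s 0 < t\<close> by (auto intro: gr0I)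
  have "t = s (k - 1)"
  proof (rule ccontr)
    assume "t \<noteq> s (k - 1)"
    with least[of "k - 1"] \<open>k \<noteq> 0\<close> k have "t \<in> {s (k - 1)<..<s k}" by auto
    then have "\<forall>\<^sub>F u in nhds t. u \<in> {s (k - 1)<..<s k}"
      by (intro eventually_nhds_in_open) auto
    then have "\<forall>\<^sub>F u in nhds t. step_fun K s v u = v k"
      by eventually_elim (use \<open>k \<noteq> 0\<close> \<open>k \<le> K\<close> in \<open>auto intro!: step_fun_epoch[OF inc]\<close>)
    with ch show False by (auto simp: changes_at_def)
  qed
  moreover have "k \<noteq> 1" using calculation \<open>s 0 < t\<close> by auto
  ultimately show ?thesis
    using \<open>k \<noteq> 0\<close> \<open>k \<le> K\<close> by (intro bexI[of _ "k - 1"]) auto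
qed

text \<open>Just before \<open>s k\<close> the value is \<open>v k\<close>; at \<open>s k\<close>
  itself it is already \<open>v (k + 1)\<close>, because epochs are closed on the left. Local
  constancy would equate the two.\<close>

lemma changes_at_boundary:
  assumes inc: "\<forall>k\<in>{1..K}. s (k - 1) < s k" and k: "k \<in> {1..<K}" and "v (k + 1) \<noteq> v k"
  shows "changes_at (step_fun K s v) (s k)"
  unfolding changes_at_def
proof
  assume "\<exists>c. \<forall>\<^sub>F u in nhds (s k). step_fun K s v u = c"
  then obtain c where c: "\<forall>\<^sub>F u in nhds (s k). step_fun K s v u = c" by blast
  have right: "step_fun K s v (s k) = v (k + 1)"
    using k bspec[OF inc, of "k + 1"] by (intro step_fun_epoch[OF inc]) auto
  have "\<forall>\<^sub>F u in at_left (s k). step_fun K s v u = c"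
    using c by (simp add: eventually_at_filter eventually_mono)
  moreover have "\<forall>\<^sub>F u in at_left (s k). u \<in> {s (k - 1)<..<s k}"
    using k inc by (intro eventually_at_leftI[of "s (k - 1)"]) auto
  ultimately have "\<forall>\<^sub>F u in at_left (s k). v k = c"
  proof eventually_elim
    case (elim u)
    then show ?case using step_fun_epoch[OF inc, of k u v] k by auto
  qed
  \<comment> \<open>The filter \<open>at_left (s k)\<close> is nontrivial, so a statement free of
    \<open>u\<close> that holds eventually holds outright.\<close>
  then have "v k = c" by simp
  moreover have "v (k + 1) = c" using eventually_nhds_x_imp_x[OF c] right by simp
  ultimately show False using assms(3) by simp
qed

section \<open>Energy and path length as one family of costs\<close>

text \<open>Each summand is the perspective function of \<open>\<phi>\<close> at \<open>l k\<close>
  and \<open>epoch_len s k\<close>.\<close>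

definition rate_cost :: "nat \<Rightarrow> (nat \<Rightarrow> real) \<Rightarrow> (real \<Rightarrow> real) \<Rightarrow> (nat \<Rightarrow> real) \<Rightarrow> real" where
  "rate_cost K s \<phi> l = (\<Sum>k=1..K. epoch_len s k * \<phi> (offload_rate s l k))"

lemma energy_eq_rate_cost: "energy K s h N0 W = rate_cost K s (\<lambda>x. energy_rate N0 W x / h\<^sup>2)"
  by (simp add: fun_eq_iff energy_def rate_cost_def offload_rate_def)

lemma path_len_eq_rate_cost:
  assumes "\<forall>k\<in>{1..K}. s (k - 1) < s k"
  shows "path_len K s = rate_cost K s (\<lambda>x. sqrt (x\<^sup>2 + 1))"
proof -
  have "sqrt ((l k)\<^sup>2 + (epoch_len s k)\<^sup>2) =
      epoch_len s k * sqrt ((offload_rate s l k)\<^sup>2 + 1)" if "k \<in> {1..K}" for l k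
  proof -
    have pos: "epoch_len s k > 0" using assms that by (simp add: epoch_len_def)
    then have "(l k)\<^sup>2 + (epoch_len s k)\<^sup>2 = (epoch_len s k)\<^sup>2 * ((offload_rate s l k)\<^sup>2 + 1)"
      by (simp add: offload_rate_def field_simps)
    then show ?thesis using pos by (simp add: real_sqrt_mult)
  qed
  then show ?thesis by (auto simp: fun_eq_iff path_len_def rate_cost_def intro!: sum.cong)
qed

section \<open>The tunnel and its elementary constraints\<close>

text \<open>Gathers the data that shape the tunnel; the cost stays a parameter \<open>\<phi>\<close>
  of the lemmas, so that energy and length share them.\<close>

locale offloading =
  fixes K :: nat and s :: "nat \<Rightarrow> real" and a :: "nat \<Rightarrow> nat" and fh C Q :: real
  assumes K: "K \<ge> 1"
    and inc: "\<forall>k\<in>{1..K}. s (k - 1) < s k"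
    and states: "\<forall>k\<in>{1..K}. a k \<in> {0, 1}"
    and alternate: "\<forall>k\<in>{1..<K}. a (k + 1) \<noteq> a k"
    and idle_last: "a K = 1"
    and fh: "fh > 0" and C: "C > 0" and Q: "Q > 0"
begin

abbreviation "U \<equiv> idling_profile s a fh C"

abbreviation "feasible \<equiv> tunnel K s a fh C Q (U K)"

lemma epoch_len_pos: "k \<in> {1..K} \<Longrightarrow> epoch_len s k > 0"
  using inc by (simp add: epoch_len_def)

lemma rate_less_iff:
  assumes "i \<in> {1..K}" "j \<in> {1..K}"
  shows "offload_rate s l i < offload_rate s l j \<longleftrightarrow> l i * epoch_len s j < l j * epoch_len s i"
  using epoch_len_pos[OF assms(1)] epoch_len_pos[OF assms(2)]
  by (simp add: offload_rate_def field_simps)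

lemma U_Suc: "U (Suc k) = U k + real (a (Suc k)) * epoch_len s (Suc k) * fh / C"
  by (simp add: idling_profile_def)

lemma feasible_nonneg: "l \<in> feasible \<Longrightarrow> k \<in> {1..K} \<Longrightarrow> 0 \<le> l k"
  by (auto simp: tunnel_def policies_def)

lemma feasible_bounds:
  assumes "l \<in> feasible" "k \<in> {1..<K}"
  shows "U k \<le> (\<Sum>j=1..k. l j)" "(\<Sum>j=1..k. l j) \<le> U k + Q" "(\<Sum>j=1..k. l j) \<le> U K"
  using assms by (auto simp: tunnel_def)

lemma feasible_ext:
  assumes "l \<in> feasible" "l' \<in> feasible" "\<And>k. k \<in> {1..K} \<Longrightarrow> l k = l' k"
  shows "l = l'"
  using assms by (intro PiE_ext) (auto simp: tunnel_def policies_def)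

lemma rate_changes_with_state: "rate_changes_with_state K s a l"
  unfolding rate_changes_with_state_def
proof (intro ballI impI)
  fix t
  assume "t \<in> {s 0<..<s K}" "changes_at (step_fun K s (offload_rate s l)) t"
  then obtain k where "k \<in> {1..<K}" "t = s k" using changes_at_imp_boundary[OF inc] by blast
  then show "changes_at (step_fun K s (\<lambda>k. real (a k))) t"
    using changes_at_boundary[OF inc, of k "\<lambda>k. real (a k)"] alternate by simp
qed

section \<open>The rate conditions imply strict optimality\<close>

lemma conditions_sufficient:
  assumes sg: "strict_subgradient \<phi> d"
    and l: "l \<in> feasible"
    and up: "increases_at_full_buffer K s a fh C Q l"
    and down: "decreases_at_empty_buffer K s a fh C l"
    and l': "l' \<in> feasible" "l' \<noteq> l"
  shows "rate_cost K s \<phi> l < rate_cost K s \<phi> l'"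
proof -
  let ?r = "offload_rate s l" and ?r' = "offload_rate s l'"
  \<comment> \<open>\<open>?D k\<close> is the height of the path of \<open>l'\<close> above that of
    \<open>l\<close> at time \<open>s k\<close>.\<close>
  let ?D = "\<lambda>k. \<Sum>j=1..k. l' j - l j"
  have rate_diff: "epoch_len s k * (?r' k - ?r k) = l' k - l k" if "k \<in> {1..K}" for k
    using epoch_len_pos[OF that] by (simp add: offload_rate_def field_simps)
  \<comment> \<open>An epoch where the policies differ; it makes the summed tangent inequality
    strict.\<close>
  obtain i where i: "i \<in> {1..K}" "l' i \<noteq> l i" using feasible_ext[OF l'(1) l] l'(2) by blast
  have "(\<Sum>k=1..K. epoch_len s k * \<phi> (?r k) + d (?r k) * (l' k - l k))
      < (\<Sum>k=1..K. epoch_len s k * \<phi> (?r' k))"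
  proof (rule sum_strict_mono_ex1)
    show "\<forall>k\<in>{1..K}. epoch_len s k * \<phi> (?r k) + d (?r k) * (l' k - l k) \<le> epoch_len s k * \<phi> (?r' k)"
    proof
      fix k assume k: "k \<in> {1..K}"
      have "epoch_len s k * (\<phi> (?r k) + d (?r k) * (?r' k - ?r k)) \<le> epoch_len s k * \<phi> (?r' k)"
        using epoch_len_pos[OF k] strict_subgradient_le[OF sg] by (intro mult_left_mono) auto
      then show "epoch_len s k * \<phi> (?r k) + d (?r k) * (l' k - l k) \<le> epoch_len s k * \<phi> (?r' k)"
        unfolding rate_diff[OF k, symmetric] by (simp add: algebra_simps)
    qed
    have "?r i \<noteq> ?r' i" using rate_diff[OF i(1)] i(2) by auto
    then have "epoch_len s i * (\<phi> (?r i) + d (?r i) * (?r' i - ?r i)) < epoch_len s i * \<phi> (?r' i)"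
      using epoch_len_pos[OF i(1)] strict_subgradientD[OF sg] by (intro mult_strict_left_mono) auto
    then show "\<exists>k\<in>{1..K}.
        epoch_len s k * \<phi> (?r k) + d (?r k) * (l' k - l k) < epoch_len s k * \<phi> (?r' k)"
      using i(1) by (intro bexI[of _ i]) (simp_all add: rate_diff[symmetric] algebra_simps)
  qed simp
  moreover have "0 \<le> (\<Sum>k=1..K. d (?r k) * (l' k - l k))"
  proof -
    \<comment> \<open>At a rate increase \<open>l\<close> is on the upper wall, so \<open>l'\<close>
      is not above it and both factors are nonpositive; at a decrease both are nonnegative.\<close>
    have "0 \<le> (d (?r k) - d (?r (k + 1))) * ?D k" if k: "k \<in> {1..<K}" for k
    proof (cases "?r k" "?r (k + 1)" rule: linorder_cases)
      case less
      then have "buffer s a fh C l k = Q" using up k by (auto simp: increases_at_full_buffer_def)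
      then have "?D k \<le> 0"
        using feasible_bounds(2)[OF l'(1) k] by (simp add: buffer_def sum_subtractf)
      moreover have "d (?r k) \<le> d (?r (k + 1))" using less strict_subgradient_mono[OF sg] by simp
      ultimately show ?thesis by (intro mult_nonpos_nonpos) auto
    next
      case greater
      then have "buffer s a fh C l k = 0" using down k by (auto simp: decreases_at_empty_buffer_def)
      then have "?D k \<ge> 0"
        using feasible_bounds(1)[OF l'(1) k] by (simp add: buffer_def sum_subtractf)
      moreover have "d (?r (k + 1)) \<le> d (?r k)"
        using greater strict_subgradient_mono[OF sg] by simp
      ultimately show ?thesis by simp
    qed simp
    \<comment> \<open>Both paths end at height \<open>U K\<close>, which removes the boundary term
      of the summation by parts.\<close>
    moreover have "?D K = 0" using l l' by (simp add: tunnel_def sum_subtractf)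
    ultimately show ?thesis
      unfolding sum_by_parts[OF K] by (auto intro: sum_nonneg)
  qed
  ultimately show ?thesis by (simp add: rate_cost_def sum.distrib)
qed

section \<open>Minimisers satisfy the rate conditions\<close>

text \<open>The amount \<open>e\<close> may have either sign; the last premise says that the rate difference of the
  two epochs does not change its sign.\<close>

lemma shift_decreases_cost:
  assumes sg: "strict_subgradient \<phi> d" and k: "k \<in> {1..<K}" and "e \<noteq> 0"
    and "0 \<le> e * ((l (k + 1) - e) / epoch_len s (k + 1) - (l k + e) / epoch_len s k)"
  shows "rate_cost K s \<phi> (l(k := l k + e, k + 1 := l (k + 1) - e)) < rate_cost K s \<phi> l"
proof -
  let ?t = "epoch_len s k" and ?u = "epoch_len s (k + 1)"
  \<comment> \<open>The tangents are taken at the rates \<open>x\<close> and \<open>y\<close> after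
    the transfer and evaluated at the old rates. Hence the old cost exceeds the new one by more than
    \<open>e * (d y - d x)\<close>, which is nonnegative.\<close>
  define x where "x = (l k + e) / ?t"
  define y where "y = (l (k + 1) - e) / ?u"
  have pos: "?t > 0" "?u > 0" using epoch_len_pos k by auto
  have "0 \<le> e * (d y - d x)"
  proof (cases "e > 0")
    case True
    with assms(4) have "x \<le> y" by (simp add: x_def y_def zero_le_mult_iff)
    then show ?thesis using True strict_subgradient_mono[OF sg] by simp
  next
    case False
    with assms(3,4) have "y \<le> x" by (simp add: x_def y_def zero_le_mult_iff)
    then show ?thesis
      using False strict_subgradient_mono[OF sg] by (intro mult_nonpos_nonpos) auto
  qed
  moreover have "?t * \<phi> x - d x * e < ?t * \<phi> (l k / ?t)"
  proof -
    have "x \<noteq> l k / ?t" using pos assms(3) by (simp add: x_def)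
    then have "?t * (\<phi> x + d x * (l k / ?t - x)) < ?t * \<phi> (l k / ?t)"
      using strict_subgradientD[OF sg] pos by simp
    moreover have "?t * (l k / ?t - x) = - e" using pos by (simp add: x_def field_simps)
    then have "?t * (\<phi> x + d x * (l k / ?t - x)) = ?t * \<phi> x - d x * e"
      by (simp add: distrib_left mult.left_commute[of ?t])
    ultimately show ?thesis by simp
  qed
  moreover have "?u * \<phi> y + d y * e < ?u * \<phi> (l (k + 1) / ?u)"
  proof -
    have "y \<noteq> l (k + 1) / ?u" using pos assms(3) by (simp add: y_def)
    then have "?u * (\<phi> y + d y * (l (k + 1) / ?u - y)) < ?u * \<phi> (l (k + 1) / ?u)"
      using strict_subgradientD[OF sg] pos by simp
    moreover have "?u * (l (k + 1) / ?u - y) = e" using pos by (simp add: y_def field_simps)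
    then have "?u * (\<phi> y + d y * (l (k + 1) / ?u - y)) = ?u * \<phi> y + d y * e"
      by (simp add: distrib_left mult.left_commute[of ?u])
    ultimately show ?thesis by simp
  qed
  moreover have "rate_cost K s \<phi> (l(k := l k + e, k + 1 := l (k + 1) - e)) = rate_cost K s \<phi> l
      + (?t * \<phi> x - ?t * \<phi> (l k / ?t)) + (?u * \<phi> y - ?u * \<phi> (l (k + 1) / ?u))"
    unfolding rate_cost_def offload_rate_def x_def y_def
    by (rule sum_two_updates[where f = "\<lambda>k z. epoch_len s k * \<phi> (z / epoch_len s k)"])
      (use k in auto)
  ultimately show ?thesis by (simp add: algebra_simps)
qed

text \<open>By \<open>sum_shift_adjacent\<close> only the bounds at \<open>s k\<close> and the signs
  of the two changed entries have to be rechecked.\<close>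

lemma feasible_shift:
  assumes l: "l \<in> feasible" and k: "k \<in> {1..<K}"
    and "0 \<le> l k + e" "0 \<le> l (k + 1) - e"
    and "U k \<le> (\<Sum>j=1..k. l j) + e" "(\<Sum>j=1..k. l j) + e \<le> U k + Q"
    and "(\<Sum>j=1..k. l j) + e \<le> U K"
  shows "l(k := l k + e, k + 1 := l (k + 1) - e) \<in> feasible"
proof -
  let ?l = "l(k := l k + e, k + 1 := l (k + 1) - e)"
  have "?l \<in> policies K"
    using l assms(3,4) k by (auto simp: tunnel_def policies_def PiE_iff extensional_def)
  moreover have "(\<Sum>j=1..m. ?l j) = (\<Sum>j=1..m. l j) + (if m = k then e else 0)" for m
    using sum_shift_adjacent[of k l e m] k by simp
  ultimately show ?thesis
    using l k assms(5-7) by (simp add: tunnel_def del: fun_upd_apply)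
qed

lemma partial_sum_Suc:
  fixes l :: "nat \<Rightarrow> real"
  shows "(\<Sum>j=1..k + 1. l j) = (\<Sum>j=1..k. l j) + l (k + 1)"
  by simp

lemma minimiser_increases_at_full_buffer:
  assumes sg: "strict_subgradient \<phi> d"
    and l: "l \<in> feasible" and min: "\<And>l'. l' \<in> feasible \<Longrightarrow> rate_cost K s \<phi> l \<le> rate_cost K s \<phi> l'"
  shows "increases_at_full_buffer K s a fh C Q l"
  unfolding increases_at_full_buffer_def
proof (intro ballI impI)
  fix k
  assume k: "k \<in> {1..<K}" and less: "offload_rate s l k < offload_rate s l (k + 1)"
  let ?t = "epoch_len s k" and ?u = "epoch_len s (k + 1)" and ?S = "\<Sum>j=1..k. l j"
  have pos: "?t > 0" "?u > 0" using epoch_len_pos k by auto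
  have gap: "l k * ?u < l (k + 1) * ?t" using less rate_less_iff[of k "k + 1" l] k by simp
  have nonneg: "0 \<le> l k" using feasible_nonneg[OF l] k by simp
  have "0 < l (k + 1) * ?t" using gap nonneg pos by (smt (verit) mult_nonneg_nonneg)
  then have l_pos: "0 < l (k + 1)" using pos by (simp add: zero_less_mult_iff)
  \<comment> \<open>Epoch \<open>k + 1\<close> still offloads a positive amount, so the path at
    \<open>s k\<close> is strictly below its final height.\<close>
  have S_less: "?S < U K"
  proof -
    have "(\<Sum>j=1..k + 1. l j) \<le> (\<Sum>j=1..K. l j)"
      using k feasible_nonneg[OF l] by (intro sum_mono2) auto
    then show ?thesis using l l_pos by (simp add: tunnel_def)
  qed
  have full: "?S = U k + Q"
  proof (rule ccontr)
    assume "?S \<noteq> U k + Q"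
    then have slack: "?S < U k + Q" using feasible_bounds(2)[OF l k] by simp
    \<comment> \<open>The first two terms keep the raised path under the buffer bound and the cap
      \<open>U K\<close>, the third keeps entry \<open>k + 1\<close> nonnegative, and the fourth is
      the transfer that equalises the two rates.\<close>
    define e where "e = Min {U k + Q - ?S, U K - ?S, l (k + 1), (l (k + 1) * ?t - l k * ?u) / (?t + ?u)}"
    have e: "0 < e" "e \<le> U k + Q - ?S" "e \<le> U K - ?S" "e \<le> l (k + 1)"
      "e \<le> (l (k + 1) * ?t - l k * ?u) / (?t + ?u)"
      unfolding e_def using slack S_less l_pos gap pos by auto
    then have "(l k + e) * ?u \<le> (l (k + 1) - e) * ?t"
      using pos by (simp add: pos_le_divide_eq algebra_simps)
    then have "(l k + e) / ?t \<le> (l (k + 1) - e) / ?u"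
      using pos by (simp add: frac_le_eq field_simps)
    then have "rate_cost K s \<phi> (l(k := l k + e, k + 1 := l (k + 1) - e)) < rate_cost K s \<phi> l"
      using e by (intro shift_decreases_cost[OF sg k]) auto
    moreover have "l(k := l k + e, k + 1 := l (k + 1) - e) \<in> feasible"
      using e nonneg feasible_bounds(1)[OF l k] by (intro feasible_shift[OF l k]) auto
    ultimately show False using min by force
  qed
  \<comment> \<open>The buffer bound at \<open>k + 1\<close> is available only for
    \<open>k + 1 < K\<close>; the last epoch is idle by assumption. In a busy epoch \<open>U\<close>
    stands still, so offloading into a full buffer would overflow it.\<close>
  have "a (k + 1) = 1"
  proof (cases "k + 1 = K")
    case True
    then show ?thesis using idle_last by simp
  next
    case False
    then have k1: "k + 1 \<in> {1..<K}" using k by simp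
    have "a (k + 1) \<noteq> 0"
    proof
      assume "a (k + 1) = 0"
      then have "U (k + 1) = U k" using U_Suc[of k] by simp
      then show False
        using feasible_bounds(2)[OF l k1] full l_pos unfolding partial_sum_Suc by simp
    qed
    then show ?thesis using states k1 by force
  qed
  then show "a (k + 1) = 1 \<and> buffer s a fh C l k = Q" using full by (simp add: buffer_def)
qed

lemma minimiser_decreases_at_empty_buffer:
  assumes sg: "strict_subgradient \<phi> d"
    and l: "l \<in> feasible" and min: "\<And>l'. l' \<in> feasible \<Longrightarrow> rate_cost K s \<phi> l \<le> rate_cost K s \<phi> l'"
  shows "decreases_at_empty_buffer K s a fh C l"
  unfolding decreases_at_empty_buffer_def
proof (intro ballI impI)
  fix k
  assume k: "k \<in> {1..<K}" and less: "offload_rate s l (k + 1) < offload_rate s l k"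
  let ?t = "epoch_len s k" and ?u = "epoch_len s (k + 1)" and ?S = "\<Sum>j=1..k. l j"
  have pos: "?t > 0" "?u > 0" using epoch_len_pos k by auto
  have gap: "l (k + 1) * ?t < l k * ?u" using less rate_less_iff[of "k + 1" k l] k by simp
  have nonneg: "0 \<le> l (k + 1)" using feasible_nonneg[OF l] k by simp
  have "0 < l k * ?u" using gap nonneg pos by (smt (verit) mult_nonneg_nonneg)
  then have l_pos: "0 < l k" using pos by (simp add: zero_less_mult_iff)
  have empty: "?S = U k"
  proof (rule ccontr)
    assume "?S \<noteq> U k"
    then have slack: "U k < ?S" using feasible_bounds(1)[OF l k] by simp
    \<comment> \<open>Now bits are postponed: the terms keep the path above the lower wall, keep
      entry \<open>k\<close> nonnegative, and stop at equal rates.\<close>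
    define e where "e = Min {?S - U k, l k, (l k * ?u - l (k + 1) * ?t) / (?t + ?u)}"
    have e: "0 < e" "e \<le> ?S - U k" "e \<le> l k"
      "e \<le> (l k * ?u - l (k + 1) * ?t) / (?t + ?u)"
      unfolding e_def using slack l_pos gap pos by auto
    then have "(l (k + 1) + e) * ?t \<le> (l k - e) * ?u"
      using pos by (simp add: pos_le_divide_eq algebra_simps)
    then have "(l (k + 1) + e) / ?u \<le> (l k - e) / ?t"
      using pos by (simp add: field_simps)
    then have "rate_cost K s \<phi> (l(k := l k + - e, k + 1 := l (k + 1) - - e)) < rate_cost K s \<phi> l"
      using e by (intro shift_decreases_cost[OF sg k]) (auto simp: mult_le_0_iff)
    moreover have "l(k := l k + - e, k + 1 := l (k + 1) - - e) \<in> feasible"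
      using e nonneg feasible_bounds(2,3)[OF l k] by (intro feasible_shift[OF l k]) auto
    ultimately show False using min by force
  qed
  \<comment> \<open>If epoch \<open>k + 1\<close> were idle, epoch \<open>k\<close> would be busy
    and \<open>U\<close> constant on it. Since \<open>l k > 0\<close>, the buffer could not be empty
    at the end of epoch \<open>k\<close>.\<close>
  have "a (k + 1) \<noteq> 1"
  proof
    assume "a (k + 1) = 1"
    moreover have "a k \<in> {0, 1}" "a (k + 1) \<noteq> a k" using states alternate k by simp_all
    ultimately have "a k = 0" by auto
    moreover obtain m where m: "k = m + 1" using k by (cases k) auto
    ultimately have "U m = U k" using U_Suc[of m] by simp
    moreover have "U m \<le> (\<Sum>j=1..m. l j)"
    proof (cases m)
      \<comment> \<open>The tunnel has no constraint at index 0; there both sides are empty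
        sums.\<close>
      case 0
      then show ?thesis by (simp add: idling_profile_def)
    next
      case (Suc i)
      then show ?thesis using feasible_bounds(1)[OF l, of m] k m by simp
    qed
    moreover have "?S = (\<Sum>j=1..m. l j) + l k" using m by simp
    ultimately show False using empty l_pos by simp
  qed
  then have "a (k + 1) = 0" using states k by force
  then show "a (k + 1) = 0 \<and> buffer s a fh C l k = 0" using empty by (simp add: buffer_def)
qed

section \<open>Nonemptiness, compactness and continuity\<close>

lemma feasible_nonempty: "feasible \<noteq> {}"
proof -
  \<comment> \<open>Offload in each epoch exactly what the CPU can process in it: the path is then
    the lower wall \<open>U\<close>.\<close>
  define l where "l = restrict (\<lambda>k. real (a k) * epoch_len s k * fh / C) {1..K}"
  have nonneg: "0 \<le> real (a k) * epoch_len s k * fh / C" if "k \<in> {1..K}" for k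
    using epoch_len_pos[OF that] fh C by simp
  have sum: "(\<Sum>j=1..k. l j) = U k" if "k \<le> K" for k
    using that unfolding idling_profile_def l_def by (intro sum.cong) auto
  have "U k \<le> U K" if "k \<le> K" for k
    unfolding idling_profile_def using that nonneg by (intro sum_mono2) auto
  moreover have "l \<in> policies K" using nonneg by (auto simp: l_def policies_def)
  ultimately have "l \<in> feasible" using sum Q by (simp add: tunnel_def)
  then show ?thesis by blast
qed

lemma compact_feasible: "compact feasible"
proof -
  \<comment> \<open>The singleton factors outside \<open>{1..K}\<close> encode extensionality, so
    the policies lie in a product of compact sets; Tychonoff's theorem applies, and the remaining
    constraints are closed.\<close>
  define B where "B k = (if k \<in> {1..K} then {0..U K} else {undefined})" for k
  have "compactin (product_topology (\<lambda>_. euclidean) UNIV) (PiE UNIV B)"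
    unfolding compactin_PiE by (auto simp: B_def)
  then have compact: "compact (PiE UNIV B)" by (simp add: euclidean_product_topology)
  have cont: "continuous_on UNIV (\<lambda>l :: nat \<Rightarrow> real. \<Sum>j=1..k. l j)" for k :: nat
    by (intro continuous_intros continuous_on_product_coordinates)
  have "feasible = PiE UNIV B \<inter>
      ((\<Inter>k\<in>{1..<K}. {l. U k \<le> (\<Sum>j=1..k. l j)} \<inter> {l. (\<Sum>j=1..k. l j) \<le> min (U k + Q) (U K)})
        \<inter> {l. (\<Sum>j=1..K. l j) = U K})"
    (is "_ = PiE UNIV B \<inter> ?S")
  proof (intro equalityI subsetI)
    fix l assume l: "l \<in> feasible"
    have "l k \<le> U K" if "k \<in> {1..K}" for k
    proof -
      have "l k \<le> (\<Sum>j=1..K. l j)" using that feasible_nonneg[OF l] by (intro member_le_sum) auto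
      then show ?thesis using l by (simp add: tunnel_def)
    qed
    moreover have "l k = undefined" if "k \<notin> {1..K}" for k
      using l that PiE_arb[of l "{1..K}" "\<lambda>_. {0..}" k] by (simp add: tunnel_def policies_def)
    ultimately have "l \<in> PiE UNIV B"
      using feasible_nonneg[OF l] by (intro PiE_I) (simp_all add: B_def)
    then show "l \<in> PiE UNIV B \<inter> ?S" using l by (auto simp: tunnel_def)
  next
    fix l assume l: "l \<in> PiE UNIV B \<inter> ?S"
    then have lB: "l k \<in> B k" for k by (auto simp: PiE_iff)
    have "l k \<in> {0..}" if "k \<in> {1..K}" for k
      using lB[of k] that by (simp add: B_def)
    moreover have "l k = undefined" if "k \<notin> {1..K}" for k
      using lB[of k] that by (auto simp: B_def split: if_splits)
    ultimately have "l \<in> policies K" unfolding policies_def by (intro PiE_I)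
    then show "l \<in> feasible" using l by (auto simp: tunnel_def)
  qed
  moreover have "closed ?S"
    by (intro closed_Int closed_INT ballI closed_Collect_le closed_Collect_eq cont continuous_on_const)
  ultimately show ?thesis using compact by (simp add: compact_Int_closed)
qed

lemma continuous_rate_cost:
  assumes "continuous_on UNIV \<phi>"
  shows "continuous_on A (rate_cost K s \<phi>)"
  unfolding rate_cost_def offload_rate_def divide_inverse
  by (intro continuous_intros continuous_on_compose2[OF assms]
      continuous_on_subset[OF continuous_on_product_coordinates]) auto

section \<open>Characterisation, existence and uniqueness of the optimum\<close>

definition "optimal l \<longleftrightarrow> l \<in> feasible \<and>
  increases_at_full_buffer K s a fh C Q l \<and> decreases_at_empty_buffer K s a fh C l"

text \<open>The right-hand side is free of \<open>\<phi>\<close>, so this equivalence identifies the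
  minimisers of energy and of length.\<close>

lemma is_arg_min_iff_optimal:
  assumes "strict_subgradient \<phi> d"
  shows "is_arg_min (rate_cost K s \<phi>) (\<lambda>l. l \<in> feasible) l \<longleftrightarrow> optimal l"
proof
  assume "is_arg_min (rate_cost K s \<phi>) (\<lambda>l. l \<in> feasible) l"
  then have "l \<in> feasible" "\<And>l'. l' \<in> feasible \<Longrightarrow> rate_cost K s \<phi> l \<le> rate_cost K s \<phi> l'"
    by (auto simp: is_arg_min_linorder)
  then show "optimal l"
    unfolding optimal_def
    by (intro conjI minimiser_increases_at_full_buffer[OF assms]
        minimiser_decreases_at_empty_buffer[OF assms])
next
  assume "optimal l"
  then have "rate_cost K s \<phi> l < rate_cost K s \<phi> l'" if "l' \<in> feasible" "l' \<noteq> l" for l'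
    using conditions_sufficient[OF assms] that by (simp add: optimal_def)
  then show "is_arg_min (rate_cost K s \<phi>) (\<lambda>l. l \<in> feasible) l"
    using \<open>optimal l\<close> by (force simp: is_arg_min_linorder optimal_def)
qed

lemma optimal_exists: "\<exists>l. optimal l"
proof -
  let ?\<phi> = "\<lambda>x :: real. sqrt (x\<^sup>2 + 1)"
  have "continuous_on UNIV ?\<phi>" by (intro continuous_intros)
  then obtain l where "l \<in> feasible"
    "\<And>l'. l' \<in> feasible \<Longrightarrow> rate_cost K s ?\<phi> l \<le> rate_cost K s ?\<phi> l'"
    using continuous_attains_inf[OF compact_feasible feasible_nonempty continuous_rate_cost] by metis
  then have "optimal l"
    using minimiser_increases_at_full_buffer[OF strict_subgradient_sqrt]
      minimiser_decreases_at_empty_buffer[OF strict_subgradient_sqrt] by (auto simp: optimal_def)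
  then show ?thesis by blast
qed

text \<open>Two distinct optimal policies would each have strictly smaller cost than the
  other.\<close>

lemma optimal_unique: "optimal l \<Longrightarrow> optimal l' \<Longrightarrow> l = l'"
  using conditions_sufficient[OF strict_subgradient_sqrt, of l l']
    conditions_sufficient[OF strict_subgradient_sqrt, of l' l]
  unfolding optimal_def by (metis order.asym)

end

theorem proposition1:
  fixes K :: nat and s :: "nat \<Rightarrow> real" and a :: "nat \<Rightarrow> nat"
    and fh C Q h N0 W T_end L :: real
  assumes "K \<ge> 1"
    and "s 0 = 0" and "s K = T_end" and "\<forall>k\<in>{1..K}. s (k - 1) < s k"
    and "\<forall>k\<in>{1..K}. a k \<in> {0, 1}" and "\<forall>k\<in>{1..<K}. a (k + 1) \<noteq> a k" and "a K = 1"
    and "fh > 0" and "C > 0" and "Q > 0" and "h > 0" and "N0 > 0" and "W > 0"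
    and "L = idling_profile s a fh C K"
  shows "(\<exists>!lstar. energy_efficient K s a fh C Q h N0 W L lstar) \<and>
    (\<exists>!l. shortest_path K s (tunnel K s a fh C Q L) (0, 0) (T_end, L) l) \<and>
    (\<forall>lstar. energy_efficient K s a fh C Q h N0 W L lstar \<longrightarrow>
       shortest_path K s (tunnel K s a fh C Q L) (0, 0) (T_end, L) lstar \<and>
       (\<forall>k\<in>{1..K}. lstar k = offload_rate s lstar k * epoch_len s k) \<and>
       (\<forall>l\<in>tunnel K s a fh C Q L.
          (\<forall>k\<in>{1..K}. offload_rate s l k = offload_rate s lstar k) \<longleftrightarrow>
          rate_changes_with_state K s a l \<and>
          increases_at_full_buffer K s a fh C Q l \<and>
          decreases_at_empty_buffer K s a fh C l))"
proof -
  interpret offloading K s a fh C Q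
    using assms by unfold_locales auto
  have energy: "energy_efficient K s a fh C Q h N0 W L l \<longleftrightarrow> optimal l" for l
    unfolding energy_efficient_def energy_eq_rate_cost \<open>L = U K\<close>
    by (rule is_arg_min_iff_optimal[OF strict_subgradient_energy_rate]) fact+
  \<comment> \<open>Every policy in the tunnel already joins the prescribed endpoints, so the
    shortest path minimises over the whole tunnel.\<close>
  have endpoints: "l \<in> feasible \<and> path_vertex s l 0 = (0, 0) \<and> path_vertex s l K = (T_end, U K)
      \<longleftrightarrow> l \<in> feasible" for l
    using \<open>s 0 = 0\<close> \<open>s K = T_end\<close> by (auto simp: path_vertex_def tunnel_def)
  have path: "shortest_path K s (tunnel K s a fh C Q L) (0, 0) (T_end, L) l \<longleftrightarrow> optimal l" for l
    unfolding shortest_path_def path_len_eq_rate_cost[OF inc] \<open>L = U K\<close> endpoints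
    by (rule is_arg_min_iff_optimal[OF strict_subgradient_sqrt])
  have unique: "\<exists>!l. optimal l" using optimal_exists optimal_unique by blast
  have rate_eq: "l k = offload_rate s l k * epoch_len s k" if "k \<in> {1..K}" for l k
    using epoch_len_pos[OF that] by (simp add: offload_rate_def)
  have "(\<forall>k\<in>{1..K}. offload_rate s l k = offload_rate s l' k) \<longleftrightarrow>
      rate_changes_with_state K s a l \<and> increases_at_full_buffer K s a fh C Q l \<and>
      decreases_at_empty_buffer K s a fh C l"
    if l': "optimal l'" and l: "l \<in> feasible" for l l'
  proof -
    \<comment> \<open>Rates determine the entries, as epoch lengths are positive, and the entries
      determine the extensional policy.\<close>
    have "(\<forall>k\<in>{1..K}. offload_rate s l k = offload_rate s l' k) \<longleftrightarrow> l = l'"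
      using feasible_ext[OF l, of l'] rate_eq l' by (metis optimal_def)
    also have "\<dots> \<longleftrightarrow> optimal l" using l' unique by blast
    finally show ?thesis using l rate_changes_with_state by (simp add: optimal_def)
  qed
  then show ?thesis using unique rate_eq unfolding energy path unfolding \<open>L = U K\<close> by blast
qed

end
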